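(* Let $\mu_X,\mu_Y\in\mathbb{R}$, $\sigma_X,\sigma_Y>0$, $\rho\in(-1,1)$ and let $n\geq1$ be an integer. Let $(X,Y)$ be a bivariate normal random vector with mean vector $(\mu_X,\mu_Y)$, variances $(\sigma_X^2,\sigma_Y^2)$ and correlation coefficient $\rho$, let $Z=XY$, and let $S_n=\sum_{i=1}^n Z_i$, where $Z_1,\ldots,Z_n$ are independent copies of $Z$. Put $s=\sigma_X\sigma_Y$ and $$\lambda_+=\frac{n}{2(1+\rho)}\bigg(\frac{\mu_X}{\sigma_X}+\frac{\mu_Y}{\sigma_Y}\bigg)^2,\quad \lambda_-=\frac{n}{2(1-\rho)}\bigg(\frac{\mu_X}{\sigma_X}-\frac{\mu_Y}{\sigma_Y}\bigg)^2.$$ Then, for integers $k\geq1$, $$\mathbb{E}[S_n^k]=\frac{s^k\mathrm{e}^{-(\lambda_++\lambda_-)/2}}{(\Gamma(n/2))^2}\sum_{j=0}^k\binom{k}{j}(1+\rho)^j(\rho-1)^{k-j}\,\Gamma\bigg(j+\frac{n}{2}\bigg)\Gamma\bigg(k-j+\frac{n}{2}\bigg) M\bigg(j+\frac{n}{2},\frac{n}{2},\frac{\lambda_+}{2}\bigg)M\bigg(k-j+\frac{n}{2},\frac{n}{2},\frac{\lambda_-}{2}\bigg).$$ Also, the cumulants of $S_n$ are given by $$\kappa_k=\frac{s^k}{2}(k-1)!\,[(1+\rho)^k(n+k\lambda_+)+(-1)^k(1-\rho)^k(n+k\lambda_-)],\quad k\geq1.$$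
   Context: $M(a,b,x)={}_1F_1(a,b,x)$ is the confluent hypergeometric function of the first kind (Kummer's function). *)

theory Defs
  imports "HOL-Probability.Probability"
begin

text \<open>The library's generalized hypergeometric series with one upper and one lower parameter,
  \<open>\<Sum>m. pochhammer a m / (pochhammer b m * fact m) * x ^ m\<close>; junk if \<open>b\<close> is a nonpositive integer.\<close>

definition kummer_M :: "real \<Rightarrow> real \<Rightarrow> real \<Rightarrow> real" where
  "kummer_M a b x = eval_fps (fps_hypergeo [a] [b] 1) x"

definition bivariate_normal_density ::
    "real \<Rightarrow> real \<Rightarrow> real \<Rightarrow> real \<Rightarrow> real \<Rightarrow> real \<times> real \<Rightarrow> real" where
  "bivariate_normal_density \<mu>X \<mu>Y \<sigma>X \<sigma>Y \<rho> = (\<lambda>(x, y).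
     1 / (2 * pi * \<sigma>X * \<sigma>Y * sqrt (1 - \<rho>\<^sup>2)) *
     exp (- 1 / (2 * (1 - \<rho>\<^sup>2)) *
       (((x - \<mu>X) / \<sigma>X)\<^sup>2
        - 2 * \<rho> * ((x - \<mu>X) / \<sigma>X) * ((y - \<mu>Y) / \<sigma>Y)
        + ((y - \<mu>Y) / \<sigma>Y)\<^sup>2)))"

text \<open>Meaningful in the nondegenerate case only: positive \<open>\<sigma>X\<close>, \<open>\<sigma>Y\<close> (standard deviations)
  and correlation coefficient \<open>\<rho>\<close> strictly between \<open>-1\<close> and \<open>1\<close>.\<close>

definition bivariate_normal ::
    "'a measure \<Rightarrow> ('a \<Rightarrow> real) \<Rightarrow> ('a \<Rightarrow> real) \<Rightarrow>
     real \<Rightarrow> real \<Rightarrow> real \<Rightarrow> real \<Rightarrow> real \<Rightarrow> bool" where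
  "bivariate_normal M X Y \<mu>X \<mu>Y \<sigma>X \<sigma>Y \<rho> \<longleftrightarrow>
     distributed M (lborel \<Otimes>\<^sub>M lborel) (\<lambda>\<omega>. (X \<omega>, Y \<omega>))
       (\<lambda>p. ennreal (bivariate_normal_density \<mu>X \<mu>Y \<sigma>X \<sigma>Y \<rho> p))"

definition mgf :: "'a measure \<Rightarrow> ('a \<Rightarrow> real) \<Rightarrow> real \<Rightarrow> real" where
  "mgf M X t = (LINT \<omega>|M. exp (t * X \<omega>))"

text \<open>The \<open>k\<close>-th derivative at 0 of the cumulant generating function; junk unless the moment
  generating function is finite in a neighbourhood of 0.\<close>

definition cumulant :: "'a measure \<Rightarrow> ('a \<Rightarrow> real) \<Rightarrow> nat \<Rightarrow> real" where
  "cumulant M X k = (deriv ^^ k) (\<lambda>t. ln (mgf M X t)) 0"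

end

theory Submission
  imports Defs
begin

text \<open>
  Diagonalising the product explains the shape of both formulas. Write
  \<open>s = \<sigma>X * \<sigma>Y\<close>. From \<open>4 * u * v = (u + v)\<^sup>2 - (u - v)\<^sup>2\<close> with \<open>u = X / \<sigma>X\<close>, \<open>v = Y / \<sigma>Y\<close>, and because \<open>u + v\<close> and
  \<open>u - v\<close> are independent normal variables with variances \<open>2 * (1 + \<rho>)\<close> and \<open>2 * (1 - \<rho>)\<close>, the
  sum \<open>S\<close> is distributed as \<open>s * ((1 + \<rho>) * P - (1 - \<rho>) * Q)\<close>, where \<open>2 * P\<close> and \<open>2 * Q\<close> are
  independent noncentral chi-square variables with \<open>n\<close> degrees of freedom and noncentrality
  parameters \<open>lam_p\<close> and \<open>lam_m\<close>.

  The proof works with the moment generating function instead of this decomposition in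
  distribution. Near \<open>0\<close> the function of \<open>S\<close> is the product of two explicit factors, one for each
  chi-square variable. For \<open>n = 1\<close> this is a two-dimensional Gaussian integral
  (\<open>nn_integral_normal_product\<close>, \<open>mgf_normal_product\<close>), whose quadratic form is diagonal in the
  coordinates \<open>u + v\<close> and \<open>u - v\<close>; independence turns the general case into an \<open>n\<close>-th power
  (\<open>mgf_sum_iid\<close>), and \<open>n\<close>-th powers of the factors are again such factors
  (\<open>chisq_factor_power\<close>).

  The moments are the coefficients of this function at \<open>t ^ k / fact k\<close>
  (\<open>moments_from_exponential_integrability\<close>). Expanding each factor first in powers of
  \<open>1 / (1 - w)\<close> and then in powers of \<open>w\<close> produces Kummer functions as coefficients
  (\<open>has_sum_kummer_generating_function\<close>), and the Cauchy product of the two expansions is the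
  claimed binomial sum (\<open>chisq_factor_product_sums\<close>, \<open>powser_coeff_unique\<close>). The cumulants come
  from the logarithm, which splits into two elementary functions that can be differentiated
  \<open>k\<close> times in closed form (\<open>higher_deriv_ln_chisq_product\<close>).
\<close>

section \<open>Gaussian integrals\<close>

lemma nn_integral_gaussian:
  fixes A B C :: real
  assumes "A > 0"
  shows "(\<integral>\<^sup>+y. ennreal (exp (2 * B * y - A * y\<^sup>2 - C)) \<partial>lborel)
    = ennreal (sqrt (pi / A) * exp (B\<^sup>2 / A - C))"
proof -
  define \<sigma> where "\<sigma> = 1 / sqrt (2 * A)"
  have \<sigma>: "\<sigma> > 0" "\<sigma>\<^sup>2 = 1 / (2 * A)"
    using assms by (auto simp: \<sigma>_def power_divide)
  have eq: "exp (2 * B * y - A * y\<^sup>2 - C) =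
      (sqrt (pi / A) * exp (B\<^sup>2 / A - C)) * normal_density (B / A) \<sigma> y" for y
  proof -
    have "2 * B * y - A * y\<^sup>2 - C = (B\<^sup>2 / A - C) + (- (y - B / A)\<^sup>2 / (2 * \<sigma>\<^sup>2))"
      using assms unfolding \<sigma>(2) by (simp add: field_simps power2_eq_square)
    then have "exp (2 * B * y - A * y\<^sup>2 - C) =
        exp (B\<^sup>2 / A - C) * exp (- (y - B / A)\<^sup>2 / (2 * \<sigma>\<^sup>2))"
      by (simp only: exp_add)
    moreover have "sqrt (2 * pi * \<sigma>\<^sup>2) = sqrt (pi / A)"
      unfolding \<sigma>(2) by simp
    moreover have "sqrt (pi / A) \<noteq> 0" using assms by simp
    ultimately show ?thesis
      unfolding normal_density_def by simp
  qed
  have "(\<integral>\<^sup>+y. ennreal (normal_density (B / A) \<sigma> y) \<partial>lborel) = 1"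
    using \<sigma>(1) by (simp add: nn_integral_eq_integral)
  then show ?thesis
    unfolding eq using assms by (simp add: ennreal_mult nn_integral_cmult)
qed

text \<open>The inner integral over the second coordinate is one-dimensional and Gaussian, with a linear
  coefficient that depends on \<open>x\<close>. Completing the square leaves a Gaussian in \<open>x\<close> with leading
  coefficient \<open>p - q\<^sup>2 / r\<close>, the Schur complement. Up to the constant \<open>c\<close>, the exponent on the
  right is the quadratic form of the inverse matrix at \<open>(l, m)\<close>.\<close>

lemma nn_integral_gaussian2:
  fixes p q r l m c :: real
  assumes "r > 0" and "p * r - q\<^sup>2 > 0"
  shows "(\<integral>\<^sup>+z. ennreal (exp (2 * l * fst z + 2 * m * snd z
            - (p * (fst z)\<^sup>2 + 2 * q * fst z * snd z + r * (snd z)\<^sup>2) - c)) \<partial>(lborel \<Otimes>\<^sub>M lborel))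
    = ennreal (pi / sqrt (p * r - q\<^sup>2) *
        exp ((r * l\<^sup>2 - 2 * q * l * m + p * m\<^sup>2) / (p * r - q\<^sup>2) - c))"
    (is "?I = ?R")
proof -
  define A where "A = p - q\<^sup>2 / r"
  have A: "A = (p * r - q\<^sup>2) / r"
    using assms by (simp add: A_def field_simps)
  then have Apos: "A > 0" using assms by simp
  have inner: "(\<integral>\<^sup>+y. ennreal (exp (2 * l * x + 2 * m * y
                  - (p * x\<^sup>2 + 2 * q * x * y + r * y\<^sup>2) - c)) \<partial>lborel)
      = ennreal (sqrt (pi / r)) *
        ennreal (exp (2 * (l - q * m / r) * x - A * x\<^sup>2 - (c - m\<^sup>2 / r)))" for x
  proof -
    have "(\<integral>\<^sup>+y. ennreal (exp (2 * l * x + 2 * m * y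
                  - (p * x\<^sup>2 + 2 * q * x * y + r * y\<^sup>2) - c)) \<partial>lborel)
        = (\<integral>\<^sup>+y. ennreal (exp (2 * (m - q * x) * y - r * y\<^sup>2
                    - (p * x\<^sup>2 - 2 * l * x + c))) \<partial>lborel)"
      by (simp add: algebra_simps)
    also have "\<dots> = ennreal (sqrt (pi / r) *
        exp ((m - q * x)\<^sup>2 / r - (p * x\<^sup>2 - 2 * l * x + c)))"
      by (rule nn_integral_gaussian[OF assms(1)])
    also have "(m - q * x)\<^sup>2 / r - (p * x\<^sup>2 - 2 * l * x + c)
        = 2 * (l - q * m / r) * x - A * x\<^sup>2 - (c - m\<^sup>2 / r)"
      using assms(1) by (simp add: A_def field_simps power2_eq_square)
    finally show ?thesis using assms(1) by (simp add: ennreal_mult)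
  qed
  have "?I = (\<integral>\<^sup>+x. (\<integral>\<^sup>+y. ennreal (exp (2 * l * x + 2 * m * y
                  - (p * x\<^sup>2 + 2 * q * x * y + r * y\<^sup>2) - c)) \<partial>lborel) \<partial>lborel)"
    by (subst lborel.nn_integral_fst[symmetric]) simp_all
  also have "\<dots> = ennreal (sqrt (pi / r)) *
      (\<integral>\<^sup>+x. ennreal (exp (2 * (l - q * m / r) * x - A * x\<^sup>2 - (c - m\<^sup>2 / r))) \<partial>lborel)"
    unfolding inner by (simp add: nn_integral_cmult)
  also have "\<dots> = ennreal (sqrt (pi / r) *
      (sqrt (pi / A) * exp ((l - q * m / r)\<^sup>2 / A - (c - m\<^sup>2 / r))))"
    using assms(1) Apos by (subst nn_integral_gaussian[OF Apos]) (simp add: ennreal_mult)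
  also have "sqrt (pi / r) * (sqrt (pi / A) * exp ((l - q * m / r)\<^sup>2 / A - (c - m\<^sup>2 / r)))
      = pi / sqrt (p * r - q\<^sup>2) *
        exp ((r * l\<^sup>2 - 2 * q * l * m + p * m\<^sup>2) / (p * r - q\<^sup>2) - c)"
  proof -
    have "pi / r * (pi / A) = pi\<^sup>2 / (p * r - q\<^sup>2)"
      using assms by (simp add: A power2_eq_square)
    then have "sqrt (pi / r) * sqrt (pi / A) = pi / sqrt (p * r - q\<^sup>2)"
      by (simp only: real_sqrt_mult[symmetric]) (simp add: real_sqrt_divide)
    moreover
    define D where "D = p * r - q\<^sup>2"
    have "(l - q * m / r)\<^sup>2 / A - (c - m\<^sup>2 / r)
        = (r * l\<^sup>2 - 2 * q * l * m + p * m\<^sup>2) / D - c"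
    proof -
      have p: "p = (D + q\<^sup>2) / r" and D: "D > 0"
        using assms by (simp_all add: D_def)
      have "(l - q * m / r)\<^sup>2 / A = (l * r - q * m)\<^sup>2 / (r * D)"
        using assms(1) D unfolding A D_def[symmetric] by (simp add: field_simps power2_eq_square)
      moreover have "(l * r - q * m)\<^sup>2 / (r * D) + m\<^sup>2 / r
          = (r * l\<^sup>2 - 2 * q * l * m + p * m\<^sup>2) / D"
        using assms(1) D unfolding p by (simp add: field_simps power2_eq_square)
      ultimately show ?thesis by simp
    qed
    ultimately show ?thesis
      by (simp only: D_def mult.assoc[symmetric])
  qed
  finally show ?thesis .
qed

section \<open>The moment generating function\<close>

text \<open>The value at \<open>w\<close> of the moment generating function of one half of a noncentral chi-square
  variable with \<open>2 * h\<close> degrees of freedom and noncentrality parameter \<open>2 * x\<close>; halving removes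
  all factors of two from the Kummer coefficients below.\<close>

definition chisq_factor :: "real \<Rightarrow> real \<Rightarrow> real \<Rightarrow> real" where
  "chisq_factor h x w = exp (x * w / (1 - w)) * (1 - w) powr (- h)"

lemma chisq_factor_pos: "w < 1 \<Longrightarrow> chisq_factor h x w > 0"
  by (simp add: chisq_factor_def)

lemma chisq_factor_power:
  assumes "w < 1"
  shows "chisq_factor h x w ^ n = chisq_factor (real n * h) (real n * x) w"
proof -
  have "((1 - w) powr (- h)) ^ n = (1 - w) powr (- (real n * h))"
    using assms by (simp add: powr_def exp_of_nat_mult[symmetric] mult_ac)
  then show ?thesis
    by (simp add: chisq_factor_def power_mult_distrib exp_of_nat_mult[symmetric])
qed

text \<open>In the standardised coordinates \<open>u = x / \<sigma>X\<close>, \<open>v = y / \<sigma>Y\<close> the exponent has quadratic part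
  \<open>- (K * u\<^sup>2 - 2 * \<kappa> * u * v + K * v\<^sup>2)\<close>: the factor \<open>exp (t * x * y)\<close> only changes the mixed
  coefficient. Its eigenvectors are therefore \<open>(1, 1)\<close> and \<open>(1, - 1)\<close> for every \<open>t\<close>, with
  eigenvalues \<open>K - \<kappa>\<close> and \<open>K + \<kappa>\<close>, proportional to \<open>1 - wp\<close> and \<open>1 - wm\<close>. This is why the
  integral splits into two factors, and why it converges when \<open>wp < 1\<close> and \<open>wm < 1\<close>.\<close>

lemma nn_integral_normal_product:
  fixes \<mu>X \<mu>Y \<sigma>X \<sigma>Y \<rho> t :: real
  defines "a \<equiv> \<mu>X / \<sigma>X" and "b \<equiv> \<mu>Y / \<sigma>Y"
    and "wp \<equiv> \<sigma>X * \<sigma>Y * (1 + \<rho>) * t" and "wm \<equiv> - (\<sigma>X * \<sigma>Y * (1 - \<rho>) * t)"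
  assumes \<sigma>: "\<sigma>X > 0" "\<sigma>Y > 0" and \<rho>: "-1 < \<rho>" "\<rho> < 1" and w: "wp < 1" "wm < 1"
  shows "(\<integral>\<^sup>+z. ennreal (bivariate_normal_density \<mu>X \<mu>Y \<sigma>X \<sigma>Y \<rho> z) *
            ennreal (exp (t * (fst z * snd z))) \<partial>(lborel \<Otimes>\<^sub>M lborel))
    = ennreal (chisq_factor (1 / 2) ((a + b)\<^sup>2 / (4 * (1 + \<rho>))) wp *
               chisq_factor (1 / 2) ((a - b)\<^sup>2 / (4 * (1 - \<rho>))) wm)"
proof -
  define s where "s = \<sigma>X * \<sigma>Y"
  define K where "K = 1 / (2 * (1 - \<rho>\<^sup>2))"
  define \<kappa> where "\<kappa> = \<rho> * K + t * s / 2"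
  define L where "L = K * (a - \<rho> * b)"
  define N where "N = K * (b - \<rho> * a)"
  define c where "c = K * (a\<^sup>2 - 2 * \<rho> * a * b + b\<^sup>2)"
  (* Coefficients of the exponent in the original coordinates x and y; K, \<kappa>, L and N are the
     corresponding ones in the standardised coordinates. *)
  define p q r l m where defs: "p = K / \<sigma>X\<^sup>2" "q = - \<kappa> / s" "r = K / \<sigma>Y\<^sup>2" "l = L / \<sigma>X" "m = N / \<sigma>Y"
  define xp where "xp = (a + b)\<^sup>2 / (4 * (1 + \<rho>))"
  define xm where "xm = (a - b)\<^sup>2 / (4 * (1 - \<rho>))"
  have fact: "1 - \<rho>\<^sup>2 = (1 + \<rho>) * (1 - \<rho>)" by (simp add: algebra_simps power2_eq_square)
  have pos: "1 + \<rho> > 0" "1 - \<rho> > 0" "1 - \<rho>\<^sup>2 > 0" using \<rho> by (auto simp: fact)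
  have s: "s > 0" using \<sigma> by (simp add: s_def)
  have K: "K > 0" "K = 1 / (2 * ((1 + \<rho>) * (1 - \<rho>)))"
    using pos by (simp_all add: K_def fact)
  have Km: "K * (1 - \<rho>) = 1 / (2 * (1 + \<rho>))" and Kp: "K * (1 + \<rho>) = 1 / (2 * (1 - \<rho>))"
    using pos by (simp_all add: K(2))
  have wm': "1 - wp > 0" "1 - wm > 0" using w by auto
  have wps: "wp = s * (1 + \<rho>) * t" "wm = - (s * (1 - \<rho>) * t)" by (simp_all add: wp_def wm_def s_def)
  have Kminus: "K - \<kappa> = (1 - wp) / (2 * (1 + \<rho>))"
  proof -
    have "K - \<kappa> = K * (1 - \<rho>) - t * s / 2" by (simp add: \<kappa>_def algebra_simps)
    also have "\<dots> = (1 - wp) / (2 * (1 + \<rho>))"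
      unfolding Km using pos by (simp add: wps field_simps)
    finally show ?thesis .
  qed
  have Kplus: "K + \<kappa> = (1 - wm) / (2 * (1 - \<rho>))"
  proof -
    have "K + \<kappa> = K * (1 + \<rho>) + t * s / 2" by (simp add: \<kappa>_def algebra_simps)
    also have "\<dots> = (1 - wm) / (2 * (1 - \<rho>))"
      unfolding Kp using pos by (simp add: wps field_simps)
    finally show ?thesis .
  qed
  have Kpos: "K - \<kappa> > 0" "K + \<kappa> > 0" unfolding Kminus Kplus using pos wm' by simp_all
  have D: "p * r - q\<^sup>2 = (K - \<kappa>) * (K + \<kappa>) / s\<^sup>2"
    using \<sigma> by (simp add: defs s_def field_simps power2_eq_square)
  have D': "(K - \<kappa>) * (K + \<kappa>) = (1 - wp) * (1 - wm) / (4 * (1 - \<rho>\<^sup>2))"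
    unfolding Kminus Kplus fact by (simp add: divide_simps) (simp add: algebra_simps)
  have Dpos: "p * r - q\<^sup>2 > 0" unfolding D using Kpos s by simp
  have r: "r > 0" using K \<sigma> by (simp add: defs)
  define c0 where "c0 = 1 / (2 * pi * s * sqrt (1 - \<rho>\<^sup>2))"
  have c0: "c0 > 0" using s pos by (simp add: c0_def)
  have integrand: "bivariate_normal_density \<mu>X \<mu>Y \<sigma>X \<sigma>Y \<rho> z * exp (t * (fst z * snd z)) =
      c0 * exp (2 * l * fst z + 2 * m * snd z
            - (p * (fst z)\<^sup>2 + 2 * q * fst z * snd z + r * (snd z)\<^sup>2) - c)" for z
  proof -
    obtain x y where z: "z = (x, y)" by (cases z)
    define u v where uv: "u = x / \<sigma>X" "v = y / \<sigma>Y"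
    have x: "x = \<sigma>X * u" "y = \<sigma>Y * v" using \<sigma> by (simp_all add: uv)
    have sub: "(x - \<mu>X) / \<sigma>X = u - a" "(y - \<mu>Y) / \<sigma>Y = v - b"
      by (simp_all add: uv a_def b_def diff_divide_distrib)
    have "l * x = L * u" "m * y = N * v" "p * x\<^sup>2 = K * u\<^sup>2" "r * y\<^sup>2 = K * v\<^sup>2" "q * x * y = - \<kappa> * u * v"
      using \<sigma> by (simp_all add: x defs s_def power_mult_distrib)
    then have "2 * l * x + 2 * m * y - (p * x\<^sup>2 + 2 * q * x * y + r * y\<^sup>2) - c
        = 2 * L * u + 2 * N * v - (K * u\<^sup>2 - 2 * \<kappa> * u * v + K * v\<^sup>2) - c"
      by (simp add: mult.assoc)
    also have "\<dots> = - K * ((u - a)\<^sup>2 - 2 * \<rho> * (u - a) * (v - b) + (v - b)\<^sup>2) + t * (x * y)"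
      unfolding L_def N_def c_def \<kappa>_def x s_def by (simp add: algebra_simps power2_eq_square)
    finally have e: "2 * l * x + 2 * m * y - (p * x\<^sup>2 + 2 * q * x * y + r * y\<^sup>2) - c
       = - K * ((u - a)\<^sup>2 - 2 * \<rho> * (u - a) * (v - b) + (v - b)\<^sup>2) + t * (x * y)" .
    have K': "- 1 / (2 * (1 - \<rho>\<^sup>2)) = - K" by (simp add: K_def)
    show ?thesis
      unfolding z fst_conv snd_conv e bivariate_normal_density_def prod.case sub K' exp_add
      by (simp add: c0_def s_def mult.assoc)
  qed
  have "(\<integral>\<^sup>+z. ennreal (bivariate_normal_density \<mu>X \<mu>Y \<sigma>X \<sigma>Y \<rho> z) *
            ennreal (exp (t * (fst z * snd z))) \<partial>(lborel \<Otimes>\<^sub>M lborel))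
    = (\<integral>\<^sup>+z. ennreal c0 * ennreal (exp (2 * l * fst z + 2 * m * snd z
            - (p * (fst z)\<^sup>2 + 2 * q * fst z * snd z + r * (snd z)\<^sup>2) - c)) \<partial>(lborel \<Otimes>\<^sub>M lborel))"
    using c0 by (simp add: integrand flip: ennreal_mult'')
  also have "\<dots> = ennreal (c0 * (pi / sqrt (p * r - q\<^sup>2) *
        exp ((r * l\<^sup>2 - 2 * q * l * m + p * m\<^sup>2) / (p * r - q\<^sup>2) - c)))"
    using c0 by (subst nn_integral_cmult)
      (auto simp: nn_integral_gaussian2[OF r Dpos] simp flip: ennreal_mult')
  also have "c0 * (pi / sqrt (p * r - q\<^sup>2) *
        exp ((r * l\<^sup>2 - 2 * q * l * m + p * m\<^sup>2) / (p * r - q\<^sup>2) - c))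
     = chisq_factor (1 / 2) xp wp * chisq_factor (1 / 2) xm wm"
  proof -
    have "sqrt (p * r - q\<^sup>2) = sqrt (1 - wp) * sqrt (1 - wm) / (2 * sqrt (1 - \<rho>\<^sup>2) * s)"
      unfolding D D' real_sqrt_divide real_sqrt_mult using s by simp
    then have pre: "c0 * (pi / sqrt (p * r - q\<^sup>2)) = (1 - wp) powr (- (1/2)) * (1 - wm) powr (- (1/2))"
      using s pos wm' by (simp add: c0_def powr_minus powr_half_sqrt field_simps)
    have diag: "(U / (2 * d))\<^sup>2 / (2 * (v / (2 * d))) = U\<^sup>2 / (4 * d) / v"
      if "d > 0" "v > 0" for U d v :: real
      using that by (simp add: power2_eq_square)
    have "r * l\<^sup>2 - 2 * q * l * m + p * m\<^sup>2 = (K * L\<^sup>2 + 2 * \<kappa> * L * N + K * N\<^sup>2) / s\<^sup>2"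
      using \<sigma> by (simp add: defs s_def field_simps power2_eq_square)
    (* Diagonal form of the adjugate matrix: its eigenvectors are again (1, 1) and (1, -1). *)
    also have "K * L\<^sup>2 + 2 * \<kappa> * L * N + K * N\<^sup>2
        = ((L + N)\<^sup>2 * (K + \<kappa>) + (L - N)\<^sup>2 * (K - \<kappa>)) / 2"
      by (simp add: field_simps power2_eq_square)
    finally have "(r * l\<^sup>2 - 2 * q * l * m + p * m\<^sup>2) / (p * r - q\<^sup>2)
        = ((L + N)\<^sup>2 * (K + \<kappa>) + (L - N)\<^sup>2 * (K - \<kappa>)) / 2 / ((K - \<kappa>) * (K + \<kappa>))"
      unfolding D using s by simp
    also have "\<dots> = (L + N)\<^sup>2 / (2 * (K - \<kappa>)) + (L - N)\<^sup>2 / (2 * (K + \<kappa>))"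
    proof -
      have "(U * k + V * j) / 2 / (j * k) = U / (2 * j) + V / (2 * k)"
        if "j > 0" "k > 0" for U V j k :: real
        using that by (simp add: field_simps)
      from this[OF Kpos] show ?thesis .
    qed
    also have "L + N = (a + b) / (2 * (1 + \<rho>))"
    proof -
      have "L + N = K * (1 - \<rho>) * (a + b)" by (simp add: L_def N_def algebra_simps)
      then show ?thesis by (simp add: Km)
    qed
    also have "L - N = (a - b) / (2 * (1 - \<rho>))"
    proof -
      have "L - N = K * (1 + \<rho>) * (a - b)" by (simp add: L_def N_def algebra_simps)
      then show ?thesis by (simp add: Kp)
    qed
    also have "((a + b) / (2 * (1 + \<rho>)))\<^sup>2 / (2 * (K - \<kappa>)) = xp / (1 - wp)"
      unfolding Kminus xp_def using pos wm' by (intro diag) auto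
    also have "((a - b) / (2 * (1 - \<rho>)))\<^sup>2 / (2 * (K + \<kappa>)) = xm / (1 - wm)"
      unfolding Kplus xm_def using pos wm' by (intro diag) auto
    finally have q: "(r * l\<^sup>2 - 2 * q * l * m + p * m\<^sup>2) / (p * r - q\<^sup>2) = xp / (1 - wp) + xm / (1 - wm)" .
    have c: "c = xp + xm"
      unfolding c_def xp_def xm_def K(2) using pos by (simp add: field_simps power2_eq_square)
    have "xp / (1 - wp) + xm / (1 - wm) - c = xp * wp / (1 - wp) + xm * wm / (1 - wm)"
    proof -
      have "x / (1 - w) = x + x * w / (1 - w)" if "1 - w > 0" for x w :: real
        using that by (simp add: field_simps)
      from this[OF wm'(1), of xp] this[OF wm'(2), of xm] show ?thesis
        unfolding c by linarith
    qed
    then show ?thesis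
      using arg_cong[OF pre, of "\<lambda>u. u * exp (xp / (1 - wp) + xm / (1 - wm) - c)"]
      unfolding q by (simp add: chisq_factor_def exp_add mult_ac)
  qed
  finally show ?thesis unfolding xp_def xm_def .
qed

lemma mgf_normal_product:
  fixes \<mu>X \<mu>Y \<sigma>X \<sigma>Y \<rho> t :: real
  defines "a \<equiv> \<mu>X / \<sigma>X" and "b \<equiv> \<mu>Y / \<sigma>Y"
    and "wp \<equiv> \<sigma>X * \<sigma>Y * (1 + \<rho>) * t" and "wm \<equiv> - (\<sigma>X * \<sigma>Y * (1 - \<rho>) * t)"
  assumes \<sigma>: "\<sigma>X > 0" "\<sigma>Y > 0" and \<rho>: "-1 < \<rho>" "\<rho> < 1" and w: "wp < 1" "wm < 1"
    and XY: "bivariate_normal M X Y \<mu>X \<mu>Y \<sigma>X \<sigma>Y \<rho>"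
  shows "integrable M (\<lambda>\<omega>. exp (t * (X \<omega> * Y \<omega>)))"
    and "mgf M (\<lambda>\<omega>. X \<omega> * Y \<omega>) t =
      chisq_factor (1 / 2) ((a + b)\<^sup>2 / (4 * (1 + \<rho>))) wp *
      chisq_factor (1 / 2) ((a - b)\<^sup>2 / (4 * (1 - \<rho>))) wm" (is "_ = ?F")
proof -
  note D = XY[unfolded bivariate_normal_def]
  have [measurable]: "(\<lambda>\<omega>. (X \<omega>, Y \<omega>)) \<in> M \<rightarrow>\<^sub>M lborel \<Otimes>\<^sub>M lborel"
    by (rule distributed_measurable[OF D])
  have "(\<lambda>z. exp (t * (fst z * snd z))) \<circ> (\<lambda>\<omega>. (X \<omega>, Y \<omega>)) \<in> borel_measurable M"
    by (rule measurable_comp[where N = "lborel \<Otimes>\<^sub>M lborel"]) simp_all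
  then have meas: "(\<lambda>\<omega>. exp (t * (X \<omega> * Y \<omega>))) \<in> borel_measurable M"
    by (simp add: comp_def)
  have "(\<integral>\<^sup>+\<omega>. ennreal (exp (t * (X \<omega> * Y \<omega>))) \<partial>M) = ennreal ?F"
    using distributed_nn_integral[OF D, of "\<lambda>z. ennreal (exp (t * (fst z * snd z)))"]
      nn_integral_normal_product[of \<sigma>X \<sigma>Y \<rho> t \<mu>X \<mu>Y] \<sigma> \<rho> w
    by (simp add: a_def b_def wp_def wm_def)
  moreover have "?F \<ge> 0"
    using chisq_factor_pos[OF w(1)] chisq_factor_pos[OF w(2)] by (simp add: less_imp_le)
  ultimately show "integrable M (\<lambda>\<omega>. exp (t * (X \<omega> * Y \<omega>)))"
    and "mgf M (\<lambda>\<omega>. X \<omega> * Y \<omega>) t = ?F"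
    using nn_integral_eq_integrable[OF meas, of ?F] by (auto simp: mgf_def)
qed

lemma (in prob_space) mgf_sum_iid:
  fixes Z :: "nat \<Rightarrow> 'a \<Rightarrow> real" and W :: "'b \<Rightarrow> real"
  assumes indep: "indep_vars (\<lambda>_. borel) Z {1..n}"
    and W: "W \<in> borel_measurable L"
    and dist: "\<And>i. i \<in> {1..n} \<Longrightarrow> distr M borel (Z i) = distr L borel W"
    and int: "integrable L (\<lambda>\<omega>. exp (t * W \<omega>))"
  shows "integrable M (\<lambda>\<omega>. exp (t * (\<Sum>i=1..n. Z i \<omega>)))"
    and "mgf M (\<lambda>\<omega>. \<Sum>i=1..n. Z i \<omega>) t = mgf L W t ^ n"
proof -
  have Z: "Z i \<in> borel_measurable M" if "i \<in> {1..n}" for i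
    using indep that by (auto simp: indep_vars_def)
  have exp_meas: "(\<lambda>x::real. exp (t * x)) \<in> borel_measurable borel" by simp
  have intZ: "integrable M (\<lambda>\<omega>. exp (t * Z i \<omega>))" if "i \<in> {1..n}" for i
    using int integrable_distr_eq[OF Z[OF that] exp_meas] integrable_distr_eq[OF W exp_meas] dist[OF that]
    by simp
  have mgfZ: "(\<integral>\<omega>. exp (t * Z i \<omega>) \<partial>M) = mgf L W t" if "i \<in> {1..n}" for i
    using integral_distr[OF Z[OF that] exp_meas] integral_distr[OF W exp_meas] dist[OF that]
    by (simp add: mgf_def)
  have indep': "indep_vars (\<lambda>_. borel) (\<lambda>i \<omega>. exp (t * Z i \<omega>)) {1..n}"
    using indep_vars_compose2[OF indep, of "\<lambda>_ x. exp (t * x)" "\<lambda>_. borel"] by simp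
  have prod: "exp (t * (\<Sum>i=1..n. Z i \<omega>)) = (\<Prod>i=1..n. exp (t * Z i \<omega>))" for \<omega>
    by (simp add: sum_distrib_left exp_sum)
  show "integrable M (\<lambda>\<omega>. exp (t * (\<Sum>i=1..n. Z i \<omega>)))"
    unfolding prod by (rule indep_vars_integrable) (use indep' intZ in auto)
  have "mgf M (\<lambda>\<omega>. \<Sum>i=1..n. Z i \<omega>) t = (\<Prod>i=1..n. \<integral>\<omega>. exp (t * Z i \<omega>) \<partial>M)"
    unfolding mgf_def prod by (rule indep_vars_lebesgue_integral) (use indep' intZ in auto)
  also have "\<dots> = (\<Prod>i=1..n. mgf L W t)"
    by (rule prod.cong) (use mgfZ in auto)
  finally show "mgf M (\<lambda>\<omega>. \<Sum>i=1..n. Z i \<omega>) t = mgf L W t ^ n" by simp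
qed

section \<open>Moments as power series coefficients\<close>

lemma has_sum_exp:
  fixes x :: real
  shows "((\<lambda>m. x ^ m / fact m) has_sum exp x) UNIV"
proof (rule norm_summable_imp_has_sum)
  show "(\<lambda>m. x ^ m / fact m) sums exp x"
    using exp_converges[of x] by (simp add: scaleR_conv_of_real divide_inverse mult.commute)
  show "summable (\<lambda>m. norm (x ^ m / fact m))"
    using sums_summable[OF exp_converges[of "\<bar>x\<bar>"]]
    by (simp add: scaleR_conv_of_real divide_inverse mult.commute power_abs abs_mult)
qed

lemma exp_partial_sum_le:
  fixes y :: real
  assumes "y \<ge> 0" "finite A"
  shows "(\<Sum>k\<in>A. y ^ k / fact k) \<le> exp y"
  using has_sum_imp_sums[OF has_sum_exp[of y]] assms
    sum_le_suminf[of "\<lambda>k. y ^ k / fact k" A] by (simp add: sums_iff)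

text \<open>Both a power of \<open>S\<close> and every partial sum of the exponential series of \<open>t * S\<close> are dominated, up
  to a constant, by \<open>exp (T * S) + exp (- T * S)\<close>, so dominated convergence allows integration of
  the exponential series term by term.\<close>

lemma moments_from_exponential_integrability:
  fixes S :: "'a \<Rightarrow> real"
  assumes S: "S \<in> borel_measurable N" and T: "T > 0"
    and int: "integrable N (\<lambda>\<omega>. exp (T * S \<omega>))" "integrable N (\<lambda>\<omega>. exp (- T * S \<omega>))"
  shows "integrable N (\<lambda>\<omega>. S \<omega> ^ k)"
    and "\<bar>t\<bar> \<le> T \<Longrightarrow> (\<lambda>k. (LINT \<omega>|N. S \<omega> ^ k) / fact k * t ^ k) sums mgf N S t"
proof -
  note [measurable] = S
  define B where "B \<omega> = exp (T * S \<omega>) + exp (- T * S \<omega>)" for \<omega>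
  have B: "integrable N B" unfolding B_def using int by auto
  have le: "exp (T * \<bar>S \<omega>\<bar>) \<le> B \<omega>" for \<omega>
    by (cases "S \<omega> \<ge> 0") (auto simp: B_def)
  have intS: "integrable N (\<lambda>\<omega>. S \<omega> ^ k)" for k
  proof (rule Bochner_Integration.integrable_bound)
    show "integrable N (\<lambda>\<omega>. fact k / T ^ k * B \<omega>)" using B by simp
    show "AE \<omega> in N. norm (S \<omega> ^ k) \<le> norm (fact k / T ^ k * B \<omega>)"
    proof (rule AE_I2)
      fix \<omega>
      have "(T * \<bar>S \<omega>\<bar>) ^ k / fact k \<le> B \<omega>"
        using exp_partial_sum_le[of "T * \<bar>S \<omega>\<bar>" "{k}"] T le[of \<omega>] by simp
      then have "\<bar>S \<omega>\<bar> ^ k \<le> fact k / T ^ k * B \<omega>"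
        using T by (simp add: power_mult_distrib field_simps)
      then have "norm (S \<omega> ^ k) \<le> fact k / T ^ k * B \<omega>"
        by (simp only: real_norm_def power_abs)
      also have "\<dots> \<le> norm (fact k / T ^ k * B \<omega>)"
        by (simp only: real_norm_def abs_ge_self)
      finally show "norm (S \<omega> ^ k) \<le> norm (fact k / T ^ k * B \<omega>)" .
    qed
  qed simp
  then show "integrable N (\<lambda>\<omega>. S \<omega> ^ k)" .
  assume t: "\<bar>t\<bar> \<le> T"
  have "(\<lambda>n. LINT \<omega>|N. (\<Sum>k<n. (t * S \<omega>) ^ k / fact k)) \<longlonglongrightarrow> (LINT \<omega>|N. exp (t * S \<omega>))"
  proof (rule integral_dominated_convergence[OF _ _ B])
    show "AE \<omega> in N. (\<lambda>n. \<Sum>k<n. (t * S \<omega>) ^ k / fact k) \<longlonglongrightarrow> exp (t * S \<omega>)"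
    proof (rule AE_I2)
      fix \<omega> show "(\<lambda>n. \<Sum>k<n. (t * S \<omega>) ^ k / fact k) \<longlonglongrightarrow> exp (t * S \<omega>)"
        using has_sum_imp_sums[OF has_sum_exp[of "t * S \<omega>"]] by (simp only: sums_def)
    qed
    show "AE \<omega> in N. norm (\<Sum>k<n. (t * S \<omega>) ^ k / fact k) \<le> B \<omega>" for n
    proof (rule AE_I2)
      fix \<omega>
      have "norm (\<Sum>k<n. (t * S \<omega>) ^ k / fact k) \<le> (\<Sum>k<n. \<bar>t * S \<omega>\<bar> ^ k / fact k)"
        by (rule order.trans[OF norm_sum]) (simp add: power_abs)
      also have "\<dots> \<le> exp \<bar>t * S \<omega>\<bar>" by (rule exp_partial_sum_le) simp_all
      also have "\<dots> \<le> exp (T * \<bar>S \<omega>\<bar>)"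
        using t by (simp add: abs_mult mult_right_mono)
      finally show "norm (\<Sum>k<n. (t * S \<omega>) ^ k / fact k) \<le> B \<omega>" using le[of \<omega>] by simp
    qed
  qed simp_all
  moreover have "(LINT \<omega>|N. (\<Sum>k<n. (t * S \<omega>) ^ k / fact k))
      = (\<Sum>k<n. (LINT \<omega>|N. S \<omega> ^ k) / fact k * t ^ k)" for n
    using intS by (subst Bochner_Integration.integral_sum)
      (auto simp: power_mult_distrib intro!: sum.cong)
  ultimately show "(\<lambda>k. (LINT \<omega>|N. S \<omega> ^ k) / fact k * t ^ k) sums mgf N S t"
    by (simp add: sums_def mgf_def)
qed

text \<open>Once the coefficients of the difference before \<open>n\<close> vanish, dividing it by \<open>t ^ n\<close> gives a power
  series that is zero for \<open>t \<noteq> 0\<close>; its limit at \<open>0\<close> is the \<open>n\<close>-th coefficient.\<close>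

lemma powser_coeff_unique:
  fixes a b :: "nat \<Rightarrow> real"
  assumes r: "r > 0"
    and a: "\<And>t. \<bar>t\<bar> < r \<Longrightarrow> (\<lambda>k. a k * t ^ k) sums f t"
    and b: "\<And>t. \<bar>t\<bar> < r \<Longrightarrow> (\<lambda>k. b k * t ^ k) sums f t"
  shows "a n = b n"
proof -
  define d where "d k = a k - b k" for k
  have d: "(\<lambda>k. d k * t ^ k) sums 0" if "\<bar>t\<bar> < r" for t
    using sums_diff[OF a[OF that] b[OF that]] by (simp add: d_def algebra_simps)
  have "d n = 0"
  proof (induction n rule: less_induct)
    case (less n)
    have "(\<lambda>k. d (k + n) * t ^ k) sums 0" if "t \<noteq> 0" "norm t < r" for t
    proof -
      have "(\<lambda>k. d (k + n) * t ^ (k + n)) sums 0"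
        using sums_split_initial_segment[of "\<lambda>k. d k * t ^ k" 0 n] d[of t] that less by simp
      then have "(\<lambda>k. inverse (t ^ n) * (d (k + n) * t ^ (k + n))) sums (inverse (t ^ n) * 0)"
        by (rule sums_mult)
      then show ?thesis using that by (simp add: power_add field_simps)
    qed
    then have "((\<lambda>_. 0) \<longlongrightarrow> d (0 + n)) (at (0 :: real))"
      by (rule powser_limit_0_strong[OF r])
    then show "d n = 0"
      by (simp add: tendsto_const_iff)
  qed
  then show ?thesis by (simp add: d_def)
qed

section \<open>Kummer functions and the chi-square factor\<close>

lemma has_sum_binomial_neg_power:
  fixes a w :: real
  assumes a: "a > 0" and w: "\<bar>w\<bar> < 1"
  shows "((\<lambda>j. pochhammer a j / fact j * w ^ j) has_sum (1 - w) powr (- a)) UNIV"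
proof (rule norm_summable_imp_has_sum)
  have *: "(\<lambda>j. pochhammer a j / fact j * z ^ j) sums (1 - z) powr (- a)" if "\<bar>z\<bar> < 1" for z :: real
  proof -
    have "((- a) gchoose j) * (- z) ^ j = pochhammer a j / fact j * z ^ j" for j
    proof -
      have "(-1) ^ j * (- z) ^ j = z ^ j" by (simp flip: power_mult_distrib)
      then show ?thesis by (simp add: gbinomial_pochhammer)
    qed
    with gen_binomial_real[of "- z" "- a"] that show ?thesis by simp
  qed
  from *[OF w] show "(\<lambda>j. pochhammer a j / fact j * w ^ j) sums (1 - w) powr (- a)" .
  from *[of "\<bar>w\<bar>"] w have "summable (\<lambda>j. pochhammer a j / fact j * \<bar>w\<bar> ^ j)"
    by (simp add: sums_iff)
  moreover have "pochhammer a j \<ge> 0" for j using a by (rule pochhammer_nonneg)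
  ultimately show "summable (\<lambda>j. norm (pochhammer a j / fact j * w ^ j))"
    by (simp add: abs_mult power_abs)
qed

lemma kummer_M_eqI:
  assumes "(\<lambda>m. pochhammer a m / (pochhammer b m * fact m) * x ^ m) sums y"
  shows "kummer_M a b x = y"
  using sums_unique[OF assms] by (simp add: kummer_M_def eval_fps_def)

text \<open>Both sides are the sum of the double family
  \<open>x ^ m / fact m * (pochhammer (h + m) j / fact j * w ^ j)\<close>. Summing over \<open>j\<close> first gives the
  binomial series of \<open>(1 - w) powr (- (h + m))\<close> and then an exponential series; summing over \<open>m\<close>
  first gives Kummer's series, since
  \<open>pochhammer h m * pochhammer (h + m) j = pochhammer h j * pochhammer (h + j) m\<close>. The family of
  absolute values has the same shape with \<open>\<bar>x\<bar>\<close> and \<open>\<bar>w\<bar>\<close>, so the order does not matter.\<close>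

lemma has_sum_kummer_generating_function:
  fixes h x w :: real
  assumes h: "h > 0" and w: "\<bar>w\<bar> < 1"
  shows "((\<lambda>j. pochhammer h j / fact j * kummer_M (real j + h) h x * w ^ j)
    has_sum exp (x / (1 - w)) * (1 - w) powr (- h)) UNIV"
proof -
  define f where "f x w = (\<lambda>(m, j). x ^ m / fact m * (pochhammer (h + real m) j / fact j * w ^ j))"
    for x w :: real
  have row: "((\<lambda>j. f x w (m, j)) has_sum x ^ m / fact m * (1 - w) powr (- (h + real m))) UNIV"
    if "\<bar>w\<bar> < 1" for x w m
    unfolding f_def prod.case using h that
    by (intro has_sum_cmult_right has_sum_binomial_neg_power) auto
  have total: "((\<lambda>m. x ^ m / fact m * (1 - w) powr (- (h + real m))) has_sum
      exp (x / (1 - w)) * (1 - w) powr (- h)) UNIV" if "\<bar>w\<bar> < 1" for x w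
  proof -
    have "x ^ m / fact m * (1 - w) powr (- (h + real m)) =
        (x / (1 - w)) ^ m / fact m * (1 - w) powr (- h)" for m
      using that by (simp add: powr_diff powr_realpow power_divide)
    then show ?thesis
      using has_sum_cmult_left[OF has_sum_exp[of "x / (1 - w)"], of "(1 - w) powr (- h)"] by simp
  qed
  have "f \<bar>x\<bar> \<bar>w\<bar> summable_on UNIV \<times> UNIV"
  proof (rule summable_on_SigmaI)
    show "((\<lambda>j. f \<bar>x\<bar> \<bar>w\<bar> (m, j)) has_sum \<bar>x\<bar> ^ m / fact m * (1 - \<bar>w\<bar>) powr (- (h + real m))) UNIV" for m
      by (rule row) (use w in simp)
    show "(\<lambda>m. \<bar>x\<bar> ^ m / fact m * (1 - \<bar>w\<bar>) powr (- (h + real m))) summable_on UNIV"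
      using total[of "\<bar>w\<bar>" "\<bar>x\<bar>"] w by (auto simp: summable_on_def)
    show "0 \<le> f \<bar>x\<bar> \<bar>w\<bar> (m, j)" for m j
      using h by (auto simp: f_def intro!: mult_nonneg_nonneg divide_nonneg_pos pochhammer_nonneg)
  qed
  moreover have "(\<lambda>z. norm (f x w z)) = f \<bar>x\<bar> \<bar>w\<bar>"
  proof
    fix z show "norm (f x w z) = f \<bar>x\<bar> \<bar>w\<bar> z"
    using pochhammer_nonneg[of "h + real (fst z)" "snd z"] h
    by (simp add: f_def case_prod_beta abs_mult power_abs)
  qed
  ultimately have summ: "f x w summable_on UNIV \<times> UNIV"
    by (metis abs_summable_summable)
  have "(f x w has_sum exp (x / (1 - w)) * (1 - w) powr (- h)) (UNIV \<times> UNIV)"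
    using row[OF w] total[OF w] summ by (rule has_sum_SigmaI)
  then have swapped: "((\<lambda>(j, m). f x w (m, j)) has_sum exp (x / (1 - w)) * (1 - w) powr (- h)) (UNIV \<times> UNIV)"
    by (subst (asm) has_sum_swap)
  show ?thesis
  proof (rule has_sum_SigmaD[OF swapped], unfold prod.case)
    fix j :: nat
    define c where "c = pochhammer h j / fact j * w ^ j"
    have fc: "f x w (m, j) = c * (pochhammer (real j + h) m / (pochhammer h m * fact m) * x ^ m)" for m
    proof -
      have "pochhammer h m * pochhammer (h + real m) j = pochhammer h j * pochhammer (h + real j) m"
        by (metis pochhammer_product' add.commute)
      moreover have "pochhammer h m > 0" using h by (rule pochhammer_pos)
      ultimately have "pochhammer (h + real m) j = pochhammer h j * pochhammer (h + real j) m / pochhammer h m"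
        by (simp add: field_simps)
      then show ?thesis by (simp add: f_def c_def add.commute mult_ac)
    qed
    have "(\<lambda>m. f x w (m, j)) summable_on UNIV"
      using swapped summable_on_SigmaD1[of "\<lambda>j m. f x w (m, j)" UNIV "\<lambda>_. UNIV" j]
      by (auto simp: summable_on_def)
    then obtain y where y: "((\<lambda>m. f x w (m, j)) has_sum y) UNIV"
      by (auto simp: summable_on_def)
    (* The constant c is zero when w = 0 and j > 0; then convergence of Kummer's series cannot be
       read off from the double family, but the sum is zero anyway. *)
    have "y = c * kummer_M (real j + h) h x"
    proof (cases "c = 0")
      case True
      then have "((\<lambda>m. 0 :: real) has_sum y) (UNIV :: nat set)" using y by (simp add: fc)
      then have "y = 0" by (rule has_sum_unique) (simp add: has_sum_0)
      with True show ?thesis by simp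
    next
      case False
      have "(\<lambda>m. pochhammer (real j + h) m / (pochhammer h m * fact m) * x ^ m) sums (y / c)"
        using sums_mult[OF has_sum_imp_sums[OF y], of "inverse c"] False
        by (simp add: fc divide_inverse mult.assoc[symmetric]) (simp add: mult_ac)
      from kummer_M_eqI[OF this] False show ?thesis by simp
    qed
    with y show "((\<lambda>m. f x w (m, j)) has_sum pochhammer h j / fact j * kummer_M (real j + h) h x * w ^ j) UNIV"
      by (simp add: c_def mult_ac)
  qed
qed

lemma has_sum_chisq_factor:
  fixes h x w :: real
  assumes "h > 0" and "\<bar>w\<bar> < 1"
  shows "((\<lambda>j. exp (- x) * Gamma (real j + h) / (Gamma h * fact j) * kummer_M (real j + h) h x * w ^ j)
    has_sum chisq_factor h x w) UNIV"
proof -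
  have "x * w / (1 - w) = - x + x / (1 - w)"
    using assms(2) by (simp add: field_simps)
  then have factor: "chisq_factor h x w = exp (- x) * (exp (x / (1 - w)) * (1 - w) powr (- h))"
    by (simp only: chisq_factor_def exp_add mult.assoc)
  have poch: "pochhammer h j = Gamma (real j + h) / Gamma h" for j
  proof -
    have "h \<notin> \<int>\<^sub>\<le>\<^sub>0" using assms(1) nonpos_Ints_nonpos[of h] by auto
    from pochhammer_Gamma[OF this, of j] show ?thesis by (simp only: add.commute[of h])
  qed
  have "exp (- x) * Gamma (real j + h) / (Gamma h * fact j) * kummer_M (real j + h) h x * w ^ j
      = exp (- x) * (pochhammer h j / fact j * kummer_M (real j + h) h x * w ^ j)" for j
    unfolding poch by simp
  then show ?thesis
    unfolding factor
    using has_sum_cmult_right[OF has_sum_kummer_generating_function[OF assms], of "exp (- x)" x]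
    by (simp only:)
qed

text \<open>The Cauchy product of the two expansions, with its coefficients normalised as moments: the two
  factorials and the \<open>fact k\<close> that is divided out combine to the binomial coefficient.\<close>

lemma chisq_factor_product_sums:
  fixes h xp xm \<alpha> \<beta> t :: real
  assumes h: "h > 0" and t: "\<bar>\<alpha> * t\<bar> < 1" "\<bar>\<beta> * t\<bar> < 1"
  shows "(\<lambda>k. (exp (- (xp + xm)) / (Gamma h)\<^sup>2 *
      (\<Sum>j=0..k. real (k choose j) * \<alpha> ^ j * \<beta> ^ (k - j) *
         Gamma (real j + h) * Gamma (real (k - j) + h) *
         kummer_M (real j + h) h xp * kummer_M (real (k - j) + h) h xm)) / fact k * t ^ k)
    sums (chisq_factor h xp (\<alpha> * t) * chisq_factor h xm (\<beta> * t))"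
proof -
  define c where "c x j = exp (- x) * Gamma (real j + h) / (Gamma h * fact j) * kummer_M (real j + h) h x"
    for x j
  have c: "((\<lambda>j. c x j * w ^ j) has_sum chisq_factor h x w) UNIV" if "\<bar>w\<bar> < 1" for x w
    unfolding c_def using has_sum_chisq_factor[OF h that] .
  have sm: "summable (\<lambda>j. norm (c x j * w ^ j))" if "\<bar>w\<bar> < 1" for x w
  proof -
    have "(\<lambda>j. c x j * w ^ j) summable_on UNIV" using c[OF that] by (auto simp: summable_on_def)
    then have "(\<lambda>j. norm (c x j * w ^ j)) summable_on UNIV"
      by (rule summable_on_iff_abs_summable_on_real[THEN iffD1])
    then show ?thesis by (rule summable_on_imp_summable)
  qed
  have su: "(\<Sum>j. c x j * w ^ j) = chisq_factor h x w" if "\<bar>w\<bar> < 1" for x w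
    using sums_unique[OF has_sum_imp_sums[OF c[OF that]]] by simp
  have "(\<lambda>k. \<Sum>j\<le>k. (c xp j * (\<alpha> * t) ^ j) * (c xm (k - j) * (\<beta> * t) ^ (k - j)))
      sums (chisq_factor h xp (\<alpha> * t) * chisq_factor h xm (\<beta> * t))"
    using Cauchy_product_sums[OF sm[OF t(1)] sm[OF t(2)], of xp xm] by (simp only: su[OF t(1)] su[OF t(2)])
  moreover have "(\<Sum>j\<le>k. (c xp j * (\<alpha> * t) ^ j) * (c xm (k - j) * (\<beta> * t) ^ (k - j)))
      = (exp (- (xp + xm)) / (Gamma h)\<^sup>2 *
      (\<Sum>j=0..k. real (k choose j) * \<alpha> ^ j * \<beta> ^ (k - j) *
         Gamma (real j + h) * Gamma (real (k - j) + h) *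
         kummer_M (real j + h) h xp * kummer_M (real (k - j) + h) h xm)) / fact k * t ^ k" for k
    unfolding sum_distrib_left sum_divide_distrib sum_distrib_right atLeast0AtMost
  proof (rule sum.cong[OF refl])
    fix j assume "j \<in> {..k}"
    then have jk: "j \<le> k" by simp
    have tk: "t ^ j * t ^ (k - j) = t ^ k" using jk by (simp flip: power_add)
    have bin: "real (k choose j) / fact k = 1 / (fact j * fact (k - j))"
      using binomial_fact[OF jk, where 'a = real] by simp
    have ex: "exp (- (xp + xm)) = exp (- xp) * exp (- xm)" by (simp add: exp_add[symmetric])
    show "(c xp j * (\<alpha> * t) ^ j) * (c xm (k - j) * (\<beta> * t) ^ (k - j)) =
       exp (- (xp + xm)) / (Gamma h)\<^sup>2 *
      (real (k choose j) * \<alpha> ^ j * \<beta> ^ (k - j) *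
         Gamma (real j + h) * Gamma (real (k - j) + h) *
         kummer_M (real j + h) h xp * kummer_M (real (k - j) + h) h xm) / fact k * t ^ k"
    proof -
      have "exp (- (xp + xm)) / (Gamma h)\<^sup>2 *
        (real (k choose j) * \<alpha> ^ j * \<beta> ^ (k - j) *
         Gamma (real j + h) * Gamma (real (k - j) + h) *
         kummer_M (real j + h) h xp * kummer_M (real (k - j) + h) h xm) / fact k * t ^ k
        = exp (- (xp + xm)) / (Gamma h)\<^sup>2 * (real (k choose j) / fact k) *
          (\<alpha> ^ j * \<beta> ^ (k - j) * Gamma (real j + h) * Gamma (real (k - j) + h) *
           kummer_M (real j + h) h xp * kummer_M (real (k - j) + h) h xm) * t ^ k"
        by simp
      then show ?thesis
        unfolding bin ex tk[symmetric] by (simp add: c_def power_mult_distrib power2_eq_square mult_ac)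
    qed
  qed
  ultimately show ?thesis by simp
qed

section \<open>Derivatives of the cumulant generating function\<close>

text \<open>The \<open>k\<close>-th derivative of \<open>\<lambda>t. ln (chisq_factor h x (\<alpha> * t))\<close> for \<open>k \<ge> 1\<close>, obtained from
  \<open>x / (1 - \<alpha> * t) - x - h * ln (1 - \<alpha> * t)\<close>.\<close>

definition chisq_cumulant_fun :: "real \<Rightarrow> real \<Rightarrow> real \<Rightarrow> nat \<Rightarrow> real \<Rightarrow> real" where
  "chisq_cumulant_fun h x \<alpha> k t =
     fact (k - 1) * \<alpha> ^ k * (h / (1 - \<alpha> * t) ^ k + real k * x / (1 - \<alpha> * t) ^ Suc k)"

lemma DERIV_ln_chisq_factor:
  assumes "\<alpha> * t < 1"
  shows "((\<lambda>t. ln (chisq_factor h x (\<alpha> * t))) has_real_derivative chisq_cumulant_fun h x \<alpha> 1 t) (at t)"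
proof -
  define f where "f t = x * (\<alpha> * t) / (1 - \<alpha> * t) - h * ln (1 - \<alpha> * t)" for t
  have "(f has_real_derivative chisq_cumulant_fun h x \<alpha> 1 t) (at t)"
  proof -
    define v where "v = 1 - \<alpha> * t"
    have v: "v > 0" "\<alpha> * t = 1 - v" using assms by (simp_all add: v_def)
    have "(f has_real_derivative
        (x * \<alpha> * v - x * (\<alpha> * t) * (- \<alpha>)) / (v * v) - h * (- \<alpha> / v)) (at t)"
      unfolding f_def v_def using assms by (auto intro!: derivative_eq_intros simp: mult_ac)
    moreover have "(x * \<alpha> * v - x * (\<alpha> * t) * (- \<alpha>)) / (v * v) - h * (- \<alpha> / v)
        = chisq_cumulant_fun h x \<alpha> 1 t"
      unfolding chisq_cumulant_fun_def v_def[symmetric] v(2) using v(1)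
      by (simp add: divide_simps) (simp add: algebra_simps)
    ultimately show ?thesis by simp
  qed
  then show ?thesis
  proof (rule has_field_derivative_transform_within_open)
    show "open {t. \<alpha> * t < 1}"
      by (intro open_Collect_less continuous_intros)
    show "t \<in> {t. \<alpha> * t < 1}" using assms by simp
    show "f u = ln (chisq_factor h x (\<alpha> * u))" if "u \<in> {t. \<alpha> * t < 1}" for u
      using that by (simp add: f_def chisq_factor_def ln_mult ln_powr)
  qed
qed

lemma DERIV_chisq_cumulant_fun:
  assumes "\<alpha> * t < 1" and "k \<ge> 1"
  shows "(chisq_cumulant_fun h x \<alpha> k has_real_derivative chisq_cumulant_fun h x \<alpha> (Suc k) t) (at t)"
proof -
  have pw: "((\<lambda>t. c / (1 - \<alpha> * t) ^ m) has_real_derivative real m * \<alpha> * c / (1 - \<alpha> * t) ^ Suc m) (at t)"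
    for c m
  proof (cases m)
    case (Suc l)
    define g where "g t = inverse (1 - \<alpha> * t)" for t
    have "(g has_real_derivative \<alpha> * (g t)\<^sup>2) (at t)"
      unfolding g_def using assms(1)
      by (auto intro!: derivative_eq_intros simp: power2_eq_square)
    then have "((\<lambda>t. c * g t ^ Suc l) has_real_derivative
        c * ((1 + real l) * (\<alpha> * (g t)\<^sup>2 * g t ^ l))) (at t)"
      by (intro DERIV_cmult DERIV_power_Suc)
    then show ?thesis
      unfolding Suc by (simp add: g_def divide_inverse power_inverse power2_eq_square mult_ac)
  qed simp
  have "((\<lambda>t. fact (k - 1) * \<alpha> ^ k * (h / (1 - \<alpha> * t) ^ k + real k * x / (1 - \<alpha> * t) ^ Suc k))
      has_real_derivative fact (k - 1) * \<alpha> ^ k * (real k * \<alpha> * h / (1 - \<alpha> * t) ^ Suc k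
        + real (Suc k) * \<alpha> * (real k * x) / (1 - \<alpha> * t) ^ Suc (Suc k))) (at t)"
    by (intro DERIV_cmult DERIV_add pw)
  moreover have "fact (k - 1) * \<alpha> ^ k * (real k * \<alpha> * h / (1 - \<alpha> * t) ^ Suc k
        + real (Suc k) * \<alpha> * (real k * x) / (1 - \<alpha> * t) ^ Suc (Suc k))
      = chisq_cumulant_fun h x \<alpha> (Suc k) t"
  proof -
    have "fact k = real k * fact (k - 1)" using assms(2) by (simp add: fact_reduce)
    then show ?thesis
      by (simp add: chisq_cumulant_fun_def distrib_left add_divide_distrib del: power_Suc of_nat_Suc)
         (simp add: mult_ac del: of_nat_Suc)
  qed
  ultimately show ?thesis by (simp only: chisq_cumulant_fun_def[abs_def])
qed

text \<open>The induction must prove the formula on a whole neighbourhood of \<open>0\<close>, since each further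
  derivative at a point depends on the values of the previous one nearby.\<close>

lemma higher_deriv_ln_chisq_product:
  fixes \<epsilon> :: real
  assumes \<epsilon>: "\<epsilon> > 0"
    and ab: "\<And>t. \<bar>t\<bar> < \<epsilon> \<Longrightarrow> \<alpha> * t < 1" "\<And>t. \<bar>t\<bar> < \<epsilon> \<Longrightarrow> \<beta> * t < 1"
    and f: "\<And>t. \<bar>t\<bar> < \<epsilon> \<Longrightarrow> f t = chisq_factor h x (\<alpha> * t) * chisq_factor h y (\<beta> * t)"
    and k: "k \<ge> 1"
  shows "(deriv ^^ k) (\<lambda>t. ln (f t)) 0 =
     fact (k - 1) * (\<alpha> ^ k * (h + real k * x) + \<beta> ^ k * (h + real k * y))"
proof -
  define D where "D k t = chisq_cumulant_fun h x \<alpha> k t + chisq_cumulant_fun h y \<beta> k t" for k t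
  let ?I = "{- \<epsilon> <..< \<epsilon>}"
  have I: "\<bar>t\<bar> < \<epsilon>" if "t \<in> ?I" for t using that by auto
  have "\<forall>t\<in>?I. (deriv ^^ k) (\<lambda>t. ln (f t)) t = D k t"
    using k
  proof (induction k rule: dec_induct)
    case base
    show ?case
    proof
      fix t assume t: "t \<in> ?I"
      have "((\<lambda>t. ln (chisq_factor h x (\<alpha> * t)) + ln (chisq_factor h y (\<beta> * t)))
          has_real_derivative D 1 t) (at t)"
        unfolding D_def using ab I[OF t] by (intro DERIV_add DERIV_ln_chisq_factor) auto
      then have "((\<lambda>t. ln (f t)) has_real_derivative D 1 t) (at t)"
      proof (rule has_field_derivative_transform_within_open)
        fix u assume "u \<in> ?I"
        then show "ln (chisq_factor h x (\<alpha> * u)) + ln (chisq_factor h y (\<beta> * u)) = ln (f u)"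
          using I[of u] ab[of u] by (simp add: f ln_mult_pos chisq_factor_pos)
      qed (use t in auto)
      then show "(deriv ^^ 1) (\<lambda>t. ln (f t)) t = D 1 t" by (simp add: DERIV_imp_deriv)
    qed
  next
    case (step k)
    show ?case
    proof
      fix t assume t: "t \<in> ?I"
      have "(D k has_real_derivative D (Suc k) t) (at t)"
        unfolding D_def using ab I[OF t] step.hyps by (intro DERIV_add DERIV_chisq_cumulant_fun) auto
      then have "((deriv ^^ k) (\<lambda>t. ln (f t)) has_real_derivative D (Suc k) t) (at t)"
        by (rule has_field_derivative_transform_within_open[of _ _ _ ?I]) (use t step.IH in auto)
      then show "(deriv ^^ Suc k) (\<lambda>t. ln (f t)) t = D (Suc k) t" by (simp add: DERIV_imp_deriv)
    qed
  qed
  with \<epsilon> have "(deriv ^^ k) (\<lambda>t. ln (f t)) 0 = D k 0" by simp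
  then show ?thesis by (simp add: D_def chisq_cumulant_fun_def algebra_simps)
qed

section \<open>Moments and cumulants of the sum\<close>

theorem corollary2p10:
  fixes \<mu>X \<mu>Y \<sigma>X \<sigma>Y \<rho> s lam_p lam_m :: real and n :: nat
    and M :: "'a measure" and X Y :: "'a \<Rightarrow> real"
    and N :: "'b measure" and Z :: "nat \<Rightarrow> 'b \<Rightarrow> real" and S :: "'b \<Rightarrow> real"
  assumes "\<sigma>X > 0" and "\<sigma>Y > 0" and "-1 < \<rho>" and "\<rho> < 1" and "n \<ge> 1"
    and "prob_space M" and "bivariate_normal M X Y \<mu>X \<mu>Y \<sigma>X \<sigma>Y \<rho>"
    and "prob_space N"
    and "prob_space.indep_vars N (\<lambda>_. borel) Z {1..n}"
    and "\<And>i. i \<in> {1..n} \<Longrightarrow> distr N borel (Z i) = distr M borel (\<lambda>\<omega>. X \<omega> * Y \<omega>)"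
    and "S = (\<lambda>\<omega>. \<Sum>i=1..n. Z i \<omega>)"
    and "s = \<sigma>X * \<sigma>Y"
    and "lam_p = real n / (2 * (1 + \<rho>)) * (\<mu>X / \<sigma>X + \<mu>Y / \<sigma>Y)\<^sup>2"
    and "lam_m = real n / (2 * (1 - \<rho>)) * (\<mu>X / \<sigma>X - \<mu>Y / \<sigma>Y)\<^sup>2"
  shows "(\<forall>k\<ge>1. integrable N (\<lambda>\<omega>. S \<omega> ^ k) \<and>
           (LINT \<omega>|N. S \<omega> ^ k) =
             s ^ k * exp (- (lam_p + lam_m) / 2) / (Gamma (real n / 2))\<^sup>2 *
             (\<Sum>j=0..k. real (k choose j) * (1 + \<rho>) ^ j * (\<rho> - 1) ^ (k - j) *
                Gamma (real j + real n / 2) * Gamma (real (k - j) + real n / 2) *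
                kummer_M (real j + real n / 2) (real n / 2) (lam_p / 2) *
                kummer_M (real (k - j) + real n / 2) (real n / 2) (lam_m / 2)))
       \<and> (\<exists>\<epsilon>>0. \<forall>t. \<bar>t\<bar> < \<epsilon> \<longrightarrow> integrable N (\<lambda>\<omega>. exp (t * S \<omega>)))
       \<and> (\<forall>k\<ge>1. cumulant N S k =
             s ^ k / 2 * fact (k - 1) *
             ((1 + \<rho>) ^ k * (real n + real k * lam_p)
              + (-1) ^ k * (1 - \<rho>) ^ k * (real n + real k * lam_m)))"
proof -
  note \<sigma> = assms(1,2) and \<rho> = assms(3,4) and n = assms(5) and XY = assms(7)
    and indep = assms(9) and dist = assms(10) and S_eq = assms(11) and s_eq = assms(12)
  interpret N: prob_space N by fact
  define h where "h = real n / 2"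
  define xp where "xp = lam_p / 2"
  define xm where "xm = lam_m / 2"
  define \<alpha> where "\<alpha> = s * (1 + \<rho>)"
  define \<beta> where "\<beta> = s * (\<rho> - 1)"
  (* Both 1 + \<rho> and 1 - \<rho> are below 2, so this radius keeps \<alpha> * t and \<beta> * t in (-1, 1). *)
  define \<epsilon> where "\<epsilon> = 1 / (2 * s)"
  have s: "s > 0" using \<sigma> by (simp add: s_eq)
  have h: "h > 0" using n by (simp add: h_def)
  have \<epsilon>: "\<epsilon> > 0" using s by (simp add: \<epsilon>_def)
  have radius: "\<bar>\<alpha> * t\<bar> < 1" "\<bar>\<beta> * t\<bar> < 1" if t: "\<bar>t\<bar> < \<epsilon>" for t
  proof -
    have st: "2 * s * \<bar>t\<bar> < 1" using t s by (simp add: \<epsilon>_def field_simps)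
    have "\<bar>\<alpha>\<bar> \<le> 2 * s" "\<bar>\<beta>\<bar> \<le> 2 * s"
      using s \<rho> by (simp_all add: \<alpha>_def \<beta>_def abs_mult)
    then have "\<bar>\<alpha>\<bar> * \<bar>t\<bar> \<le> 2 * s * \<bar>t\<bar>" "\<bar>\<beta>\<bar> * \<bar>t\<bar> \<le> 2 * s * \<bar>t\<bar>"
      by (auto intro: mult_right_mono)
    with st show "\<bar>\<alpha> * t\<bar> < 1" "\<bar>\<beta> * t\<bar> < 1" by (simp_all add: abs_mult)
  qed
  have "(\<lambda>\<omega>. (X \<omega>, Y \<omega>)) \<in> M \<rightarrow>\<^sub>M lborel \<Otimes>\<^sub>M lborel"
    by (rule distributed_measurable[OF XY[unfolded bivariate_normal_def]])
  from measurable_comp[OF this, of "\<lambda>z. fst z * snd z" borel]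
  have W: "(\<lambda>\<omega>. X \<omega> * Y \<omega>) \<in> borel_measurable M"
    by (simp add: comp_def)
  have Smeas: "S \<in> borel_measurable N"
    unfolding S_eq using indep
    by (intro borel_measurable_sum) (auto simp: N.indep_vars_def)
  have mgf: "integrable N (\<lambda>\<omega>. exp (t * S \<omega>)) \<and>
      mgf N S t = chisq_factor h xp (\<alpha> * t) * chisq_factor h xm (\<beta> * t)" if t: "\<bar>t\<bar> < \<epsilon>" for t
  proof -
    have w: "\<alpha> * t < 1" "\<beta> * t < 1" using radius[OF t] by auto
    have \<alpha>\<beta>: "\<sigma>X * \<sigma>Y * (1 + \<rho>) * t = \<alpha> * t" "- (\<sigma>X * \<sigma>Y * (1 - \<rho>) * t) = \<beta> * t"
      by (simp_all add: \<alpha>_def \<beta>_def s_eq algebra_simps)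
    note prod = mgf_normal_product[OF \<sigma> \<rho>, of t M X Y \<mu>X \<mu>Y, unfolded \<alpha>\<beta>, OF w XY]
    have int: "integrable N (\<lambda>\<omega>. exp (t * S \<omega>))"
      unfolding S_eq by (rule N.mgf_sum_iid(1)[OF indep W _ prod(1)]) (rule dist)
    have "mgf N S t = mgf M (\<lambda>\<omega>. X \<omega> * Y \<omega>) t ^ n"
      unfolding S_eq by (rule N.mgf_sum_iid(2)[OF indep W _ prod(1)]) (rule dist)
    also have "\<dots> = chisq_factor h xp (\<alpha> * t) * chisq_factor h xm (\<beta> * t)"
    proof -
      have "real n * ((\<mu>X / \<sigma>X + \<mu>Y / \<sigma>Y)\<^sup>2 / (4 * (1 + \<rho>))) = xp"
        and "real n * ((\<mu>X / \<sigma>X - \<mu>Y / \<sigma>Y)\<^sup>2 / (4 * (1 - \<rho>))) = xm"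
        and "real n * (1 / 2) = h"
        using \<rho> by (simp_all add: xp_def xm_def h_def assms(13,14))
      then show ?thesis
        by (simp only: prod(2) power_mult_distrib chisq_factor_power[OF w(1)] chisq_factor_power[OF w(2)])
    qed
    finally show ?thesis using int by simp
  qed
  define T where "T = \<epsilon> / 2"
  have T: "T > 0" "\<bar>T\<bar> < \<epsilon>" "\<bar>- T\<bar> < \<epsilon>" using \<epsilon> by (auto simp: T_def)
  note mom = moments_from_exponential_integrability[OF Smeas T(1)
      conjunct1[OF mgf[OF T(2)]] conjunct1[OF mgf[OF T(3)]]]
  define R where "R k = exp (- (xp + xm)) / (Gamma h)\<^sup>2 *
      (\<Sum>j=0..k. real (k choose j) * \<alpha> ^ j * \<beta> ^ (k - j) *
         Gamma (real j + h) * Gamma (real (k - j) + h) *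
         kummer_M (real j + h) h xp * kummer_M (real (k - j) + h) h xm)" for k
  have moment: "(LINT \<omega>|N. S \<omega> ^ k) = R k" for k
  proof -
    have "(LINT \<omega>|N. S \<omega> ^ k) / fact k = R k / fact k"
    proof (rule powser_coeff_unique[OF T(1)])
      fix t :: real assume t: "\<bar>t\<bar> < T"
      then have t': "\<bar>t\<bar> < \<epsilon>" using T by simp
      show "(\<lambda>k. (LINT \<omega>|N. S \<omega> ^ k) / fact k * t ^ k) sums mgf N S t"
        by (rule mom(2)) (use t in simp)
      show "(\<lambda>k. R k / fact k * t ^ k) sums mgf N S t"
        using chisq_factor_product_sums[OF h radius[OF t'], of xp xm] mgf[OF t'] by (simp add: R_def)
    qed
    then show ?thesis by simp
  qed
  have R: "R k = s ^ k * exp (- (lam_p + lam_m) / 2) / (Gamma (real n / 2))\<^sup>2 *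
             (\<Sum>j=0..k. real (k choose j) * (1 + \<rho>) ^ j * (\<rho> - 1) ^ (k - j) *
                Gamma (real j + real n / 2) * Gamma (real (k - j) + real n / 2) *
                kummer_M (real j + real n / 2) (real n / 2) (lam_p / 2) *
                kummer_M (real (k - j) + real n / 2) (real n / 2) (lam_m / 2))" for k
  proof -
    have e: "- (lam_p + lam_m) / 2 = - (xp + xm)" by (simp add: xp_def xm_def field_simps)
    have pw: "\<alpha> ^ j * \<beta> ^ (k - j) = s ^ k * ((1 + \<rho>) ^ j * (\<rho> - 1) ^ (k - j))" if "j \<le> k" for j
    proof -
      have "s ^ k = s ^ j * s ^ (k - j)" using that by (simp flip: power_add)
      then show ?thesis by (simp add: \<alpha>_def \<beta>_def power_mult_distrib)
    qed
    show ?thesis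
      unfolding R_def e h_def[symmetric] xp_def[symmetric] xm_def[symmetric] sum_distrib_left
    proof (rule sum.cong[OF refl])
      fix j assume "j \<in> {0..k}"
      then show "exp (- (xp + xm)) / (Gamma h)\<^sup>2 *
         (real (k choose j) * \<alpha> ^ j * \<beta> ^ (k - j) * Gamma (real j + h) * Gamma (real (k - j) + h) *
          kummer_M (real j + h) h xp * kummer_M (real (k - j) + h) h xm) =
         s ^ k * exp (- (xp + xm)) / (Gamma h)\<^sup>2 *
         (real (k choose j) * (1 + \<rho>) ^ j * (\<rho> - 1) ^ (k - j) * Gamma (real j + h) *
          Gamma (real (k - j) + h) * kummer_M (real j + h) h xp * kummer_M (real (k - j) + h) h xm)"
        using arg_cong[OF pw[of j], of "\<lambda>u. exp (- (xp + xm)) / (Gamma h)\<^sup>2 * (real (k choose j) * u *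
           (Gamma (real j + h) * Gamma (real (k - j) + h) *
            kummer_M (real j + h) h xp * kummer_M (real (k - j) + h) h xm))"]
        by (simp add: mult.assoc mult.left_commute)
    qed
  qed
  have cumulants: "cumulant N S k = s ^ k / 2 * fact (k - 1) *
             ((1 + \<rho>) ^ k * (real n + real k * lam_p)
              + (-1) ^ k * (1 - \<rho>) ^ k * (real n + real k * lam_m))" if k: "k \<ge> 1" for k
  proof -
    have "cumulant N S k =
        fact (k - 1) * (\<alpha> ^ k * (h + real k * xp) + \<beta> ^ k * (h + real k * xm))"
      unfolding cumulant_def
      by (rule higher_deriv_ln_chisq_product[OF \<epsilon> _ _ _ k])
        (use radius mgf in \<open>force simp: abs_less_iff\<close>)+
    moreover have "\<alpha> ^ k = s ^ k * (1 + \<rho>) ^ k" by (simp add: \<alpha>_def power_mult_distrib)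
    moreover have "\<beta> ^ k = s ^ k * ((-1) ^ k * (1 - \<rho>) ^ k)"
      by (simp add: \<beta>_def flip: power_mult_distrib)
    moreover have "h + real k * xp = (real n + real k * lam_p) / 2"
      "h + real k * xm = (real n + real k * lam_m) / 2"
      by (simp_all add: h_def xp_def xm_def field_simps)
    ultimately have "cumulant N S k = fact (k - 1) *
        (s ^ k * (1 + \<rho>) ^ k * ((real n + real k * lam_p) / 2) +
         s ^ k * ((-1) ^ k * (1 - \<rho>) ^ k) * ((real n + real k * lam_m) / 2))"
      by (simp only:)
    also have "\<dots> = s ^ k / 2 * fact (k - 1) *
             ((1 + \<rho>) ^ k * (real n + real k * lam_p)
              + (-1) ^ k * (1 - \<rho>) ^ k * (real n + real k * lam_m))"
      by (simp add: distrib_left mult_ac add_divide_distrib)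
    finally show ?thesis .
  qed
  show ?thesis
    using mom(1) moment R cumulants mgf \<epsilon> by auto
qed

end
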